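(* Let $n\geq 4$ be prime, let $G_n=\mathbb{Z}_n\times\mathbb{Z}_n$, let $S=\{(i,0),(0,i),(i,i): 1\leq i\leq n-1\}\subset G_n$, and let $\Gamma(n)=\mathrm{Cay}(G_n;S)$ (vertices $G_n$, $g\sim h$ iff $h-g\in S$). Then $\Gamma(n)$ is arc-transitive.
   Context: A graph $\Gamma$ is arc-transitive if for all vertices $u,v,x,y$ with $u\sim v$ and $x\sim y$ there is an automorphism $\pi$ of $\Gamma$ with $\pi(u)=x$ and $\pi(v)=y$. *)

theory Defs
  imports
    "HOL-Algebra.Elementary_Groups"
    "HOL-Computational_Algebra.Primes"
    "Graph_Theory.Graph_Theory"
begin

definition graph_automorphism ::
    "('a, 'b) pre_digraph \<Rightarrow> ('a, 'b, 'a, 'b) digraph_isomorphism \<Rightarrow> bool" where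
  "graph_automorphism \<Gamma> \<pi> \<longleftrightarrow> pre_digraph.digraph_isomorphism \<Gamma> \<pi> \<and> app_iso \<pi> \<Gamma> = \<Gamma>"

text \<open>
  On a graph without parallel arcs, the vertex parts of these automorphisms are precisely the
  permutations of the vertices that preserve adjacency and non-adjacency.
\<close>

lemma graph_automorphism_with_proj_iff:
  assumes "pair_wf_digraph \<Gamma>"
  shows "(\<exists>\<pi>. graph_automorphism (with_proj \<Gamma>) \<pi> \<and> iso_verts \<pi> = f) \<longleftrightarrow>
    bij_betw f (pverts \<Gamma>) (pverts \<Gamma>) \<and>
    (\<forall>u\<in>pverts \<Gamma>. \<forall>v\<in>pverts \<Gamma>. (f u, f v) \<in> parcs \<Gamma> \<longleftrightarrow> (u, v) \<in> parcs \<Gamma>)"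
    (is "?L \<longleftrightarrow> ?R")
proof
  interpret pair_wf_digraph \<Gamma> by fact
  assume ?L
  then obtain \<pi> where iso: "pre_digraph.digraph_isomorphism (with_proj \<Gamma>) \<pi>"
    and app: "app_iso \<pi> (with_proj \<Gamma>) = with_proj \<Gamma>" and f: "iso_verts \<pi> = f"
    by (auto simp: graph_automorphism_def)
  have V: "f ` pverts \<Gamma> = pverts \<Gamma>" and A: "iso_arcs \<pi> ` parcs \<Gamma> = parcs \<Gamma>"
    and t: "iso_tail \<pi> = fst" and h: "iso_head \<pi> = snd"
    using app f by (auto simp: app_iso_def with_proj_def)
  have inj: "inj_on f (pverts \<Gamma>)"
    using iso f by (auto simp: pre_digraph.digraph_isomorphism_def)
  have arc: "iso_arcs \<pi> a = (f (fst a), f (snd a))" if "a \<in> parcs \<Gamma>" for a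
    using iso that f t h by (auto simp: pre_digraph.digraph_isomorphism_def prod_eq_iff)
  have "(f u, f v) \<in> parcs \<Gamma> \<longleftrightarrow> (u, v) \<in> parcs \<Gamma>" if uv: "u \<in> pverts \<Gamma>" "v \<in> pverts \<Gamma>" for u v
  proof
    assume "(f u, f v) \<in> parcs \<Gamma>"
    then obtain a where a: "a \<in> parcs \<Gamma>" "iso_arcs \<pi> a = (f u, f v)"
      using A by (metis imageE)
    then have "f (fst a) = f u" "f (snd a) = f v" using arc by auto
    then have "fst a = u" "snd a = v"
      using inj uv a arc_fst_in_verts arc_snd_in_verts by (auto dest: inj_onD)
    then show "(u, v) \<in> parcs \<Gamma>" using a by auto
  next
    assume "(u, v) \<in> parcs \<Gamma>"
    then show "(f u, f v) \<in> parcs \<Gamma>" using A arc by force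
  qed
  then show ?R using V inj by (auto simp: bij_betw_def)
next
  interpret pair_wf_digraph \<Gamma> by fact
  assume R: ?R
  then have inj: "inj_on f (pverts \<Gamma>)" and V: "f ` pverts \<Gamma> = pverts \<Gamma>"
    by (auto simp: bij_betw_def)
  let ?g = "map_prod f f"
  let ?\<pi> = "\<lparr>iso_verts = f, iso_arcs = ?g, iso_head = snd, iso_tail = fst\<rparr>"
  have sub: "parcs \<Gamma> \<subseteq> pverts \<Gamma> \<times> pverts \<Gamma>"
    using in_arcsD1 in_arcsD2 by auto
  have injg: "inj_on ?g (parcs \<Gamma>)"
    using map_prod_inj_on[OF inj inj] sub inj_on_subset by blast
  have "?g ` parcs \<Gamma> = parcs \<Gamma>"
  proof
    show "?g ` parcs \<Gamma> \<subseteq> parcs \<Gamma>" using R sub by auto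
    show "parcs \<Gamma> \<subseteq> ?g ` parcs \<Gamma>"
    proof
      fix a assume a: "a \<in> parcs \<Gamma>"
      then have "fst a \<in> f ` pverts \<Gamma>" "snd a \<in> f ` pverts \<Gamma>"
        unfolding V by simp_all
      then obtain u v where uv: "u \<in> pverts \<Gamma>" "v \<in> pverts \<Gamma>" "a = (f u, f v)"
        by (metis imageE prod.collapse)
      then have "(u, v) \<in> parcs \<Gamma>" using R a by auto
      then show "a \<in> ?g ` parcs \<Gamma>" using uv by force
    qed
  qed
  then have "graph_automorphism (with_proj \<Gamma>) ?\<pi>"
    using inj injg V wf_digraph
    by (auto simp: graph_automorphism_def pre_digraph.digraph_isomorphism_def app_iso_def
        with_proj_def)
  then show ?L by (intro exI[of _ ?\<pi>]) simp
qed

definition arc_transitive :: "('a, 'b) pre_digraph \<Rightarrow> bool" where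
  "arc_transitive \<Gamma> \<longleftrightarrow>
    (\<forall>u\<in>verts \<Gamma>. \<forall>v\<in>verts \<Gamma>. \<forall>x\<in>verts \<Gamma>. \<forall>y\<in>verts \<Gamma>.
      u \<rightarrow>\<^bsub>\<Gamma>\<^esub> v \<and> x \<rightarrow>\<^bsub>\<Gamma>\<^esub> y \<longrightarrow>
      (\<exists>\<pi>. graph_automorphism \<Gamma> \<pi> \<and> iso_verts \<pi> u = x \<and> iso_verts \<pi> v = y))"

definition cayley_graph :: "('a, 'm) monoid_scheme \<Rightarrow> 'a set \<Rightarrow> 'a pair_pre_digraph" where
  "cayley_graph G S =
    \<lparr>pverts = carrier G,
     parcs = {(g, h). g \<in> carrier G \<and> h \<in> carrier G \<and> h \<otimes>\<^bsub>G\<^esub> inv\<^bsub>G\<^esub> g \<in> S}\<rparr>"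

definition G\<^sub>n :: "nat \<Rightarrow> (int \<times> int) monoid" where
  "G\<^sub>n n = integer_mod_group n \<times>\<times> integer_mod_group n"

definition S\<^sub>n :: "nat \<Rightarrow> (int \<times> int) set" where
  "S\<^sub>n n = (\<Union>i\<in>{1..int n - 1}. {(i, 0), (0, i), (i, i)})"

definition \<Gamma>\<^sub>n :: "nat \<Rightarrow> (int \<times> int) pair_pre_digraph" where
  "\<Gamma>\<^sub>n n = cayley_graph (G\<^sub>n n) (S\<^sub>n n)"

lemma parcs_\<Gamma>\<^sub>n_iff:
  assumes "n > 0"
  shows "((a, b), (c, d)) \<in> parcs (\<Gamma>\<^sub>n n) \<longleftrightarrow>
    {a, b, c, d} \<subseteq> {0..<int n} \<and> ((c - a) mod int n, (d - b) mod int n) \<in> S\<^sub>n n"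
  using assms
  by (auto simp: \<Gamma>\<^sub>n_def cayley_graph_def G\<^sub>n_def carrier_integer_mod_group
      mod_add_right_eq)

lemma pair_graph_\<Gamma>\<^sub>n:
  assumes "n > 0"
  shows "pair_graph (\<Gamma>\<^sub>n n)"
proof -
  have V: "pverts (\<Gamma>\<^sub>n n) = {0..<int n} \<times> {0..<int n}"
    using assms by (simp add: \<Gamma>\<^sub>n_def cayley_graph_def G\<^sub>n_def carrier_integer_mod_group)
  have sub: "parcs (\<Gamma>\<^sub>n n) \<subseteq> pverts (\<Gamma>\<^sub>n n) \<times> pverts (\<Gamma>\<^sub>n n)"
    by (auto simp: \<Gamma>\<^sub>n_def cayley_graph_def)
  have finV: "finite (pverts (\<Gamma>\<^sub>n n))" by (simp add: V)
  have finA: "finite (parcs (\<Gamma>\<^sub>n n))" using finite_subset[OF sub] finV by blast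
  have neg: "((- x) mod int n, (- y) mod int n) \<in> S\<^sub>n n" if "(x mod int n, y mod int n) \<in> S\<^sub>n n" for x y
  proof -
    have "x mod int n < int n" "y mod int n < int n" using assms by simp_all
    then show ?thesis
      using that by (auto simp: S\<^sub>n_def zmod_zminus1_eq_if intro: bexI[of _ "int n - x mod int n"])
  qed
  have symm: "sym (parcs (\<Gamma>\<^sub>n n))"
  proof (rule symI)
    fix u v assume *: "(u, v) \<in> parcs (\<Gamma>\<^sub>n n)"
    obtain a b c d where uv: "u = (a, b)" "v = (c, d)" by (cases u, cases v)
    show "(v, u) \<in> parcs (\<Gamma>\<^sub>n n)"
      using * neg[of "c - a" "d - b"] assms by (simp add: uv parcs_\<Gamma>\<^sub>n_iff)
  qed
  have loop: "fst e \<noteq> snd e" if "e \<in> parcs (\<Gamma>\<^sub>n n)" for e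
    using that assms by (cases e; cases "fst e"; cases "snd e")
      (auto simp: parcs_\<Gamma>\<^sub>n_iff S\<^sub>n_def)
  show ?thesis
    using sub finV finA symm loop by unfold_locales (auto simp: symmetric_def)
qed

end

(* The stabiliser of the identity contains the scalar multiplications together with linear maps
   permuting the three lines y = 0, x = 0 and x = y that make up S.  Combined with translations
   they carry the arc from (0, 0) to (1, 0) to every other arc. *)
theory Submission
  imports Defs
begin

text \<open>If \<open>f\<close> and \<open>g\<close> carry the base pair \<open>(p, q)\<close> to
  the arcs \<open>(u, v)\<close> and \<open>(x, y)\<close>, then g after the inverse of f carries
  \<open>(u, v)\<close> to \<open>(x, y)\<close>. Hence only maps out of one fixed pair have to be
  exhibited.\<close>

lemma arc_transitive_if_base_arc:
  assumes wf: "pair_wf_digraph \<Gamma>"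
    and base: "p \<in> pverts \<Gamma>" "q \<in> pverts \<Gamma>"
    and ex: "\<And>u v. (u, v) \<in> parcs \<Gamma> \<Longrightarrow> \<exists>f. (bij_betw f (pverts \<Gamma>) (pverts \<Gamma>) \<and>
      (\<forall>a\<in>pverts \<Gamma>. \<forall>b\<in>pverts \<Gamma>. (f a, f b) \<in> parcs \<Gamma> \<longleftrightarrow> (a, b) \<in> parcs \<Gamma>)) \<and>
      f p = u \<and> f q = v"
  shows "arc_transitive (with_proj \<Gamma>)"
  unfolding arc_transitive_def
proof (intro ballI impI)
  fix u v x y
  assume "u \<rightarrow>\<^bsub>with_proj \<Gamma>\<^esub> v \<and> x \<rightarrow>\<^bsub>with_proj \<Gamma>\<^esub> y"
  then have uv: "(u, v) \<in> parcs \<Gamma>" and xy: "(x, y) \<in> parcs \<Gamma>"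
    by (auto simp: arcs_ends_def arc_to_ends_def)
  from ex[OF uv] obtain f where f: "bij_betw f (pverts \<Gamma>) (pverts \<Gamma>)"
    and fA: "\<And>a b. \<lbrakk>a \<in> pverts \<Gamma>; b \<in> pverts \<Gamma>\<rbrakk> \<Longrightarrow> (f a, f b) \<in> parcs \<Gamma> \<longleftrightarrow> (a, b) \<in> parcs \<Gamma>"
    and fpq: "f p = u" "f q = v" by blast
  from ex[OF xy] obtain g where g: "bij_betw g (pverts \<Gamma>) (pverts \<Gamma>)"
    and gA: "\<And>a b. \<lbrakk>a \<in> pverts \<Gamma>; b \<in> pverts \<Gamma>\<rbrakk> \<Longrightarrow> (g a, g b) \<in> parcs \<Gamma> \<longleftrightarrow> (a, b) \<in> parcs \<Gamma>"
    and gpq: "g p = x" "g q = y" by blast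
  define f' where "f' = inv_into (pverts \<Gamma>) f"
  have f': "bij_betw f' (pverts \<Gamma>) (pverts \<Gamma>)"
    unfolding f'_def by (rule bij_betw_inv_into[OF f])
  have mem: "f' a \<in> pverts \<Gamma>" if "a \<in> pverts \<Gamma>" for a
    using f' that by (auto simp: bij_betw_def)
  have ff': "f (f' a) = a" if "a \<in> pverts \<Gamma>" for a
    unfolding f'_def using bij_betw_inv_into_right[OF f that] .
  have "bij_betw (g \<circ> f') (pverts \<Gamma>) (pverts \<Gamma>)"
    by (rule bij_betw_trans[OF f' g])
  \<comment> \<open>Both preservation facts are used at the preimages \<open>f' a\<close>,
    \<open>f' b\<close>: that of \<open>g\<close> removes \<open>g\<close>, and that of
    \<open>f\<close>, read backwards, restores \<open>a\<close> and \<open>b\<close>.\<close>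
  moreover have "((g \<circ> f') a, (g \<circ> f') b) \<in> parcs \<Gamma> \<longleftrightarrow> (a, b) \<in> parcs \<Gamma>"
    if "a \<in> pverts \<Gamma>" "b \<in> pverts \<Gamma>" for a b
    using that gA[OF mem mem] fA[OF mem mem] by (simp add: ff')
  ultimately obtain \<pi> where "graph_automorphism (with_proj \<Gamma>) \<pi>" "iso_verts \<pi> = g \<circ> f'"
    using graph_automorphism_with_proj_iff[OF wf, of "g \<circ> f'"] by blast
  moreover have "f' u = p" "f' v = q"
    using bij_betw_inv_into_left[OF f] base fpq unfolding f'_def by auto
  ultimately show "\<exists>\<pi>. graph_automorphism (with_proj \<Gamma>) \<pi> \<and> iso_verts \<pi> u = x \<and> iso_verts \<pi> v = y"
    using gpq by auto
qed

lemma pverts_\<Gamma>\<^sub>n: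
  assumes "n > 0"
  shows "pverts (\<Gamma>\<^sub>n n) = {0..<int n} \<times> {0..<int n}"
  using assms by (simp add: \<Gamma>\<^sub>n_def cayley_graph_def G\<^sub>n_def carrier_integer_mod_group)

text \<open>The connection set is three lines through the origin modulo n, with the origin removed.
  Divisibility expresses this for arbitrary integers, so linear maps can be computed before any
  reduction.\<close>

lemma mod_pair_in_S\<^sub>n_iff:
  assumes "n > 0"
  shows "(x mod int n, y mod int n) \<in> S\<^sub>n n \<longleftrightarrow>
    (int n dvd x \<or> int n dvd y \<or> int n dvd x - y) \<and> \<not> (int n dvd x \<and> int n dvd y)"
proof -
  have "(u, v) \<in> S\<^sub>n n \<longleftrightarrow> (u = 0 \<or> v = 0 \<or> u = v) \<and> \<not> (u = 0 \<and> v = 0)"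
    if "0 \<le> u" "u < int n" "0 \<le> v" "v < int n" for u v
    using that by (auto simp: S\<^sub>n_def)
  from this[of "x mod int n" "y mod int n"] assms
  show ?thesis
    by (simp add: dvd_eq_mod_eq_0 mod_eq_dvd_iff)
qed

lemma parcs_\<Gamma>\<^sub>n_mod_iff:
  assumes "n > 0"
  shows "((a mod int n, b mod int n), (c mod int n, d mod int n)) \<in> parcs (\<Gamma>\<^sub>n n) \<longleftrightarrow>
    (int n dvd c - a \<or> int n dvd d - b \<or> int n dvd (c - a) - (d - b)) \<and>
    \<not> (int n dvd c - a \<and> int n dvd d - b)"
  using assms by (simp add: parcs_\<Gamma>\<^sub>n_iff mod_diff_eq mod_pair_in_S\<^sub>n_iff del: mod_0_imp_dvd)

text \<open>The matrix with rows \<open>(p, q)\<close> and \<open>(r, s)\<close> acts modulo n,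
  followed by translation by \<open>(a, b)\<close>. Trivial kernel (\<open>ker\<close>) gives
  injectivity; together with invariance of the union of the three lines (\<open>lines\<close>) it
  gives preservation of adjacency.\<close>

lemma affine_automorphism_\<Gamma>\<^sub>n:
  fixes a b p q r s :: int and n :: nat
  defines "f \<equiv> \<lambda>(x, y). ((a + (p * x + q * y)) mod int n, (b + (r * x + s * y)) mod int n)"
  assumes n: "n > 0"
    and ker: "\<And>x y. int n dvd p * x + q * y \<and> int n dvd r * x + s * y \<longleftrightarrow> int n dvd x \<and> int n dvd y"
    and lines: "\<And>x y. int n dvd p * x + q * y \<or> int n dvd r * x + s * y \<or>
        int n dvd (p * x + q * y) - (r * x + s * y) \<longleftrightarrow> int n dvd x \<or> int n dvd y \<or> int n dvd x - y"
  shows "bij_betw f (pverts (\<Gamma>\<^sub>n n)) (pverts (\<Gamma>\<^sub>n n)) \<and>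
    (\<forall>u\<in>pverts (\<Gamma>\<^sub>n n). \<forall>v\<in>pverts (\<Gamma>\<^sub>n n). (f u, f v) \<in> parcs (\<Gamma>\<^sub>n n) \<longleftrightarrow> (u, v) \<in> parcs (\<Gamma>\<^sub>n n))"
proof (intro conjI ballI)
  \<comment> \<open>The translation cancels in differences, and both equality of images and
    adjacency depend on differences only.\<close>
  have lin1: "a + (p * x' + q * y') - (a + (p * x + q * y)) = p * (x' - x) + q * (y' - y)"
    and lin2: "b + (r * x' + s * y') - (b + (r * x + s * y)) = r * (x' - x) + s * (y' - y)"
    for x y x' y' by (simp_all add: algebra_simps)
  note V = pverts_\<Gamma>\<^sub>n[OF n]
  have "inj_on f (pverts (\<Gamma>\<^sub>n n))"
  proof (rule inj_onI)
    fix u v assume u: "u \<in> pverts (\<Gamma>\<^sub>n n)" and v: "v \<in> pverts (\<Gamma>\<^sub>n n)" and eq: "f u = f v"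
    obtain x y x' y' where uv: "u = (x', y')" "v = (x, y)" by (cases u, cases v)
    have "int n dvd p * (x' - x) + q * (y' - y) \<and> int n dvd r * (x' - x) + s * (y' - y)"
      using eq unfolding f_def uv prod.case prod.inject mod_eq_dvd_iff lin1 lin2 .
    then have "x' mod int n = x mod int n" "y' mod int n = y mod int n"
      by (auto simp: ker mod_eq_dvd_iff)
    then show "u = v" using u v by (simp add: uv V)
  qed
  moreover have "f ` pverts (\<Gamma>\<^sub>n n) \<subseteq> pverts (\<Gamma>\<^sub>n n)"
    using n by (auto simp: V f_def)
  \<comment> \<open>An injective map of a finite set into itself is onto, so no inverse matrix is
    required.\<close>
  ultimately show "bij_betw f (pverts (\<Gamma>\<^sub>n n)) (pverts (\<Gamma>\<^sub>n n))"
    using endo_inj_surj[of "pverts (\<Gamma>\<^sub>n n)" f] by (simp add: bij_betw_def V)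
  fix u v assume u: "u \<in> pverts (\<Gamma>\<^sub>n n)" and v: "v \<in> pverts (\<Gamma>\<^sub>n n)"
  obtain x y x' y' where uv: "u = (x, y)" "v = (x', y')" by (cases u, cases v)
  \<comment> \<open>Vertices are their own residues; inserting \<open>mod\<close> lets one
    divisibility criterion describe adjacency before and after applying \<open>f\<close>.\<close>
  have "x mod int n = x" "y mod int n = y" "x' mod int n = x'" "y' mod int n = y'"
    using u v by (simp_all add: uv V)
  then have "(u, v) \<in> parcs (\<Gamma>\<^sub>n n) \<longleftrightarrow>
    ((x mod int n, y mod int n), (x' mod int n, y' mod int n)) \<in> parcs (\<Gamma>\<^sub>n n)"
    by (simp add: uv)
  then show "(f u, f v) \<in> parcs (\<Gamma>\<^sub>n n) \<longleftrightarrow> (u, v) \<in> parcs (\<Gamma>\<^sub>n n)"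
    unfolding uv f_def prod.case parcs_\<Gamma>\<^sub>n_mod_iff[OF n] lin1 lin2 ker lines by simp
qed

theorem theorem3p2:
  fixes n :: nat
  assumes "n \<ge> 4" and "prime n"
  shows "arc_transitive (with_proj (\<Gamma>\<^sub>n n))"
proof (rule arc_transitive_if_base_arc)
  have n: "n > 0" and n1: "n > 1" using assms by simp_all
  interpret pair_graph "\<Gamma>\<^sub>n n" by (rule pair_graph_\<Gamma>\<^sub>n[OF n])
  show "pair_wf_digraph (\<Gamma>\<^sub>n n)" by unfold_locales
  show "(0, 0) \<in> pverts (\<Gamma>\<^sub>n n)" "(1, 0) \<in> pverts (\<Gamma>\<^sub>n n)"
    using n1 by (simp_all add: pverts_\<Gamma>\<^sub>n[OF n])
  have prime: "prime (int n)" using assms by simp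
  fix u v assume uv: "(u, v) \<in> parcs (\<Gamma>\<^sub>n n)"
  obtain a b c d where uv_eq: "u = (a, b)" "v = (c, d)" by (cases u, cases v)
  have mods: "a mod int n = a" "b mod int n = b" "c mod int n = c" "d mod int n = d"
    using uv by (auto simp: uv_eq parcs_\<Gamma>\<^sub>n_iff[OF n])
  have arc: "(int n dvd c - a \<or> int n dvd d - b \<or> int n dvd (c - a) - (d - b)) \<and>
    \<not> (int n dvd c - a \<and> int n dvd d - b)"
    using uv parcs_\<Gamma>\<^sub>n_mod_iff[OF n, of a b c d] by (simp only: mods uv_eq)
  have dvd_other: "int n dvd x - y \<Longrightarrow> int n dvd x \<longleftrightarrow> int n dvd y" for x y
    using dvd_add_right_iff[of "int n" "x - y" y] by simp
  have eq_if_dvd: "x = y" if "int n dvd x - y" "x mod int n = x" "y mod int n = y" for x y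
    using that by (metis mod_eq_dvd_iff)
  let ?P = "\<lambda>f. bij_betw f (pverts (\<Gamma>\<^sub>n n)) (pverts (\<Gamma>\<^sub>n n)) \<and>
    (\<forall>u\<in>pverts (\<Gamma>\<^sub>n n). \<forall>v\<in>pverts (\<Gamma>\<^sub>n n). (f u, f v) \<in> parcs (\<Gamma>\<^sub>n n) \<longleftrightarrow> (u, v) \<in> parcs (\<Gamma>\<^sub>n n))"
  \<comment> \<open>One case per line. On the axes a congruence of reduced coordinates becomes an
    equality; on the diagonal \<open>c - a\<close> and \<open>d - b\<close> may still differ by a
    multiple of n.\<close>
  consider (horizontal) "d = b" "\<not> int n dvd c - a" | (vertical) "c = a" "\<not> int n dvd d - b"
    | (diagonal) "int n dvd (c - a) - (d - b)" "\<not> int n dvd c - a"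
    using arc eq_if_dvd mods dvd_other by blast
  then show "\<exists>f. ?P f \<and> f (0, 0) = u \<and> f (1, 0) = v"
  proof cases
    case horizontal
    define k where "k = c - a"
    \<comment> \<open>Primality enters here: \<open>k\<close> is nonzero modulo n, hence
      multiplication by it is invertible.\<close>
    have k: "int n dvd k * x \<longleftrightarrow> int n dvd x" for x
      using horizontal prime unfolding k_def by (simp add: prime_dvd_mult_iff)
    let ?f = "\<lambda>(x, y). ((a + (k * x + 0 * y)) mod int n, (b + (0 * x + k * y)) mod int n)"
    have "?P ?f"
      by (rule affine_automorphism_\<Gamma>\<^sub>n[OF n]) (simp_all add: k flip: right_diff_distrib)
    moreover have "?f (0, 0) = u" "?f (1, 0) = v"
      using horizontal by (simp_all add: uv_eq mods k_def)
    ultimately show ?thesis by blast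
  next
    case vertical
    define k where "k = d - b"
    have k: "int n dvd k * x \<longleftrightarrow> int n dvd x" for x
      using vertical prime unfolding k_def by (simp add: prime_dvd_mult_iff)
    \<comment> \<open>Swapping the coordinates exchanges the two axes and fixes the diagonal;
      scaling by \<open>k\<close> then fixes all three lines.\<close>
    let ?f = "\<lambda>(x, y). ((a + (0 * x + k * y)) mod int n, (b + (k * x + 0 * y)) mod int n)"
    have "?P ?f"
    proof (rule affine_automorphism_\<Gamma>\<^sub>n[OF n])
      fix x y
      show "int n dvd 0 * x + k * y \<and> int n dvd k * x + 0 * y \<longleftrightarrow> int n dvd x \<and> int n dvd y"
        using k[of x] k[of y] by auto
      have "int n dvd 0 * x + k * y - (k * x + 0 * y) \<longleftrightarrow> int n dvd x - y"
        using k[of "y - x"] dvd_diff_commute[of "int n" x y] by (simp add: right_diff_distrib)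
      then show "int n dvd 0 * x + k * y \<or> int n dvd k * x + 0 * y \<or>
          int n dvd 0 * x + k * y - (k * x + 0 * y) \<longleftrightarrow> int n dvd x \<or> int n dvd y \<or> int n dvd x - y"
        using k[of x] k[of y] by auto
    qed
    moreover have "?f (0, 0) = u" "?f (1, 0) = v"
      using vertical by (simp_all add: uv_eq mods k_def)
    ultimately show ?thesis by blast
  next
    case diagonal
    define k where "k = c - a"
    have k: "int n dvd k * x \<longleftrightarrow> int n dvd x" for x
      using diagonal prime unfolding k_def by (simp add: prime_dvd_mult_iff)
    have k': "int n dvd k * x + (- k) * y \<longleftrightarrow> int n dvd x - y" for x y
      using k[of "x - y"] by (simp add: algebra_simps)
    have k0: "int n dvd k * x + 0 * y \<longleftrightarrow> int n dvd x" for x y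
      by (simp add: k)
    have k'': "k * x + 0 * y - (k * x + - k * y) = k * y" for x y by simp
    \<comment> \<open>The linear part sends \<open>(x, y)\<close> to \<open>k\<close> times
      \<open>(x, x - y)\<close>: it exchanges the line y = 0 with the diagonal and keeps the line x
      = 0.\<close>
    let ?f = "\<lambda>(x, y). ((a + (k * x + 0 * y)) mod int n, (b + (k * x + (- k) * y)) mod int n)"
    have "?P ?f"
    proof (rule affine_automorphism_\<Gamma>\<^sub>n[OF n])
      fix x y
      show "int n dvd k * x + 0 * y \<and> int n dvd k * x + - k * y \<longleftrightarrow> int n dvd x \<and> int n dvd y"
        unfolding k0 k' using dvd_other[of x y] dvd_diff[of "int n" x y] by blast
      show "int n dvd k * x + 0 * y \<or> int n dvd k * x + - k * y \<or>
          int n dvd k * x + 0 * y - (k * x + - k * y) \<longleftrightarrow> int n dvd x \<or> int n dvd y \<or> int n dvd x - y"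
        unfolding k'' k0 k' k by blast
    qed
    \<comment> \<open>Since \<open>k\<close> is \<open>c - a\<close>, it is only congruent to
      \<open>d - b\<close>, so the second coordinate agrees with \<open>d\<close> after
      reduction.\<close>
    moreover have "(b + k) mod int n = d mod int n"
      using diagonal by (simp add: mod_eq_dvd_iff k_def algebra_simps)
    then have "?f (0, 0) = u" "?f (1, 0) = v"
      by (simp_all add: uv_eq mods k_def)
    ultimately show ?thesis by blast
  qed
qed

end
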